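(* Let $n$ be a positive integer. There exist $\varepsilon_0>0$ and a constant $C>0$, where $C$ depends on $n$ but is independent of $\varepsilon$, such that for every $0<\varepsilon<\varepsilon_0$ the equation $$-v''(y)+\varepsilon^{n+1}v(y)v'(y)+\Big(\sum_{k=0}^n\varepsilon^k u_k(\varepsilon y)\Big)v'(y)+\Big(\sum_{k=0}^n\varepsilon^{k+1}u_k'(\varepsilon y)\Big)v(y)+F(\varepsilon y)=0$$ has a solution $v=v_{n+1}\in C^2([0,\tfrac{2\pi}{\varepsilon}])$ satisfying $$v_{n+1}(0)=v_{n+1}\Big(\frac{2\pi}{\varepsilon}\Big)\qquad\text{and}\qquad |v_{n+1}(y)|\le C\ \text{ for all } y\in\Big[0,\frac{2\pi}{\varepsilon}\Big].$$
   Context: The functions $u_k$ ($k\ge 0$) are the smooth $2\pi$-periodic functions defined by $u_0(x)=-(2+\cos x)$ and, recursively for $k\ge1$, $$u_0(x)u_k(x)=u_{k-1}'(x)-\frac12\sum_{\substack{i+j=k\\ i,j\ge1}}u_i(x)u_j(x)$$ (well defined since $u_0$ never vanishes; the sum is empty for $k=1$). The function $F$ (which depends on $n$ and $\varepsilon$) is $$F(x)=\sum_{k=1}^{n}\varepsilon^k\big(u_k(x)u_n'(x)+u_{k+1}(x)u_{n-1}'(x)+\cdots+u_n(x)u_k'(x)\big)-\varepsilon u_n''(x),$$ i.e. the coefficient of $\varepsilon^k$ in the sum is $\sum_{i=k}^{n}u_i(x)u_{n+k-i}'(x)$. In the equation, $u_k'(\varepsilon y)$ denotes the derivative $u_k'$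 evaluated at $\varepsilon y$. *)

theory Defs
  imports "HOL-Analysis.Analysis"
begin

text \<open>The recursion is solved for \<open>u (Suc k)\<close>, dividing by \<open>u\<^sub>0\<close>, which never vanishes.
  The implicit form is \<open>u_recurrence\<close> below. All \<open>u k\<close> are smooth, so \<open>deriv\<close> is the
  genuine derivative.\<close>

fun u :: "nat \<Rightarrow> real \<Rightarrow> real" where
  "u 0 = (\<lambda>x. - (2 + cos x))"
| "u (Suc k) =
    (\<lambda>x. (deriv (u k) x - 1 / 2 * (\<Sum>i = 1..k. u i x * u (Suc k - i) x)) / (- (2 + cos x)))"

definition F :: "nat \<Rightarrow> real \<Rightarrow> real \<Rightarrow> real" where
  "F n \<epsilon> x = (\<Sum>k = 1..n. \<epsilon> ^ k * (\<Sum>i = k..n. u i x * deriv (u (n + k - i)) x))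
     - \<epsilon> * deriv (deriv (u n)) x"

lemma u0_neg: "u 0 x < 0"
  using cos_ge_minus_one[of x] unfolding u.simps by linarith

lemma u_recurrence:
  assumes "k \<ge> 1"
  shows "u 0 x * u k x = deriv (u (k - 1)) x
    - 1 / 2 * (\<Sum>(i, j) | i + j = k \<and> 1 \<le> i \<and> 1 \<le> j. u i x * u j x)"
proof -
  obtain m where k: "k = Suc m"
    using assms by (cases k) auto
  have "(\<Sum>(i, j) | i + j = k \<and> 1 \<le> i \<and> 1 \<le> j. u i x * u j x)
      = (\<Sum>i = 1..m. u i x * u (Suc m - i) x)"
    by (rule sum.reindex_bij_witness[where i = "\<lambda>i. (i, Suc m - i)" and j = fst])
      (auto simp: k simp del: u.simps dest: arg_cong[where f = "\<lambda>t. t - _"], metis diff_add_inverse)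
  then show ?thesis
    using u0_neg[of x] by (simp add: k divide_simps)
qed

end

theory Submission
  imports Defs
begin

text \<open>The equation is a total derivative: with \<open>U y = (\<Sum>k\<le>n. \<epsilon>\<^sup>k u\<^sub>k (\<epsilon>y))\<close> and
  \<open>H x = \<Sum>\<^sub>k \<epsilon>\<^sup>k\<^sup>-\<^sup>1 (\<Sum>\<^sub>i u\<^sub>i u\<^bsub>n+k-i\<^esub>) / 2 - u\<^sub>n'\<close>, pairing \<open>i\<close> with
  \<open>n + k - i\<close> gives \<open>F = \<epsilon> H'\<close>, so it suffices to solve the Riccati equation
  \<open>v' = U v + \<epsilon>\<^sup>n\<^sup>+\<^sup>1 v\<^sup>2 / 2 + H(\<epsilon>y)\<close> with \<open>v 0 = v (2\<pi>/\<epsilon>)\<close>. Since \<open>u\<^sub>0 \<le> -1\<close>, the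
  coefficient \<open>U\<close> is at most \<open>-1/2\<close> for small \<open>\<epsilon>\<close>; hence the linear periodic problem
  \<open>w' = U w + g\<close> has a solution operator of norm at most \<open>2\<close> on every interval, whatever
  its length, and a contraction argument absorbs the small quadratic term.\<close>

section \<open>Periodic boundary value problems of first order\<close>

text \<open>A maximum principle: at a maximum point with value above \<open>B / a\<close> the
  right-hand side is negative, so \<open>w\<close> would be larger slightly to the left. The bound
  does not involve the length \<open>T\<close>, which later makes \<open>C\<close> independent of
  \<open>\<epsilon>\<close>.\<close>

lemma periodic_linear_upper_bound:
  fixes w U g :: "real \<Rightarrow> real"
  assumes T: "0 < T" and a: "0 < a"
    and w: "\<And>y. y \<in> {0..T} \<Longrightarrow> (w has_real_derivative U y * w y + g y) (at y within {0..T})"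
    and per: "w 0 = w T"
    and U: "\<And>y. y \<in> {0..T} \<Longrightarrow> U y \<le> - a"
    and g: "\<And>y. y \<in> {0..T} \<Longrightarrow> g y \<le> B" and B: "0 \<le> B"
    and y: "y \<in> {0..T}"
  shows "w y \<le> B / a"
proof (rule ccontr)
  assume "\<not> w y \<le> B / a"
  moreover have "continuous_on {0..T} w"
    by (rule DERIV_continuous_on[OF w])
  then obtain m where m: "m \<in> {0..T}" "\<And>z. z \<in> {0..T} \<Longrightarrow> w z \<le> w m"
    using continuous_attains_sup[of "{0..T}" w] T by auto
  \<comment> \<open>A maximum at \<open>0\<close> has no left neighbours in the interval;
    periodicity moves it to \<open>T\<close>, so the maximum point may be taken positive.\<close>
  define p where "p = (if m = 0 then T else m)"
  have p: "0 < p" "p \<in> {0..T}" "w p = w m"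
    using m(1) T per by (auto simp: p_def)
  ultimately have big: "B / a < w p"
    using m(2)[OF y] by linarith
  then have "B < a * w p" "0 < w p"
    using a B by (simp add: field_simps) (meson B a big divide_nonneg_pos le_less_trans)
  moreover have "U p * w p \<le> - a * w p"
    using U[OF p(2)] \<open>0 < w p\<close> by (intro mult_right_mono) auto
  ultimately have "U p * w p + g p < 0"
    using g[OF p(2)] by linarith
  from has_real_derivative_neg_dec_left[OF w[OF p(2)] this]
  obtain d where d: "d > 0" "\<And>h. h > 0 \<Longrightarrow> p - h \<in> {0..T} \<Longrightarrow> h < d \<Longrightarrow> w p < w (p - h)"
    by blast
  define h where "h = min (d / 2) p"
  have "h > 0" "h < d" "p - h \<in> {0..T}"
    using d(1) p by (auto simp: h_def min_def)
  then show False
    using d(2)[of h] m(2)[of "p - h"] p(3) by simp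
qed

text \<open>Apply the one-sided bound to \<open>w\<close> and to \<open>- w\<close>, which solves
  the same equation with \<open>- g\<close> in place of \<open>g\<close>.\<close>

lemma periodic_linear_bound:
  fixes w U g :: "real \<Rightarrow> real"
  assumes T: "0 < T" and a: "0 < a"
    and w: "\<And>y. y \<in> {0..T} \<Longrightarrow> (w has_real_derivative U y * w y + g y) (at y within {0..T})"
    and per: "w 0 = w T"
    and U: "\<And>y. y \<in> {0..T} \<Longrightarrow> U y \<le> - a"
    and g: "\<And>y. y \<in> {0..T} \<Longrightarrow> \<bar>g y\<bar> \<le> B"
    and y: "y \<in> {0..T}"
  shows "\<bar>w y\<bar> \<le> B / a"
proof -
  have B: "0 \<le> B"
    using g[OF y] by linarith
  have "w y \<le> B / a"
    by (rule periodic_linear_upper_bound[OF T a w per U _ B y]) (use g in fastforce)+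
  moreover have "((\<lambda>y. - w y) has_real_derivative U z * (- w z) + - g z) (at z within {0..T})"
    if "z \<in> {0..T}" for z
    using DERIV_minus[OF w[OF that]] by simp
  then have "- w y \<le> B / a"
    by (rule periodic_linear_upper_bound[OF T a _ _ U _ B y]) (use g per in fastforce)+
  ultimately show ?thesis
    by linarith
qed

text \<open>Variation of constants with \<open>exp (A y)\<close> as the homogeneous solution; the
  free constant is fixed by the boundary condition.\<close>

lemma periodic_linear_solution:
  fixes U g :: "real \<Rightarrow> real"
  assumes T: "0 < T" and a: "0 < a"
    and contU: "continuous_on {0..T} U" and contg: "continuous_on {0..T} g"
    and U: "\<And>y. y \<in> {0..T} \<Longrightarrow> U y \<le> - a"
  obtains w where
    "\<And>y. y \<in> {0..T} \<Longrightarrow> (w has_real_derivative U y * w y + g y) (at y within {0..T})"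
    "w 0 = w T"
proof -
  define A where "A y = integral {0..y} U" for y
  define I where "I y = integral {0..y} (\<lambda>s. exp (- A s) * g s)" for y
  have A: "(A has_real_derivative U y) (at y within {0..T})" if "y \<in> {0..T}" for y
    unfolding A_def using integral_has_real_derivative[OF contU that] .
  have "continuous_on {0..T} A"
    by (rule DERIV_continuous_on[OF A])
  then have "continuous_on {0..T} (\<lambda>s. exp (- A s) * g s)"
    by (intro continuous_intros contg)
  then have I: "(I has_real_derivative exp (- A y) * g y) (at y within {0..T})"
    if "y \<in> {0..T}" for y
    unfolding I_def using integral_has_real_derivative that by blast
  \<comment> \<open>Strict negativity of \<open>A T\<close> keeps the denominator
    \<open>1 - exp (A T)\<close> of \<open>c\<close> away from zero.\<close>
  have "A T \<le> integral {0..T} (\<lambda>_. - a)"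
    unfolding A_def using U by (intro integral_le integrable_continuous_real contU) auto
  also have "\<dots> < 0"
    using T a by simp
  finally have AT: "exp (A T) \<noteq> 1"
    by simp
  \<comment> \<open>The solution of \<open>c = exp (A T) * (c + I T)\<close>, which is the condition
    \<open>w 0 = w T\<close>.\<close>
  define c where "c = exp (A T) * I T / (1 - exp (A T))"
  define w where "w y = exp (A y) * (c + I y)" for y
  show thesis
  proof
    fix y assume y: "y \<in> {0..T}"
    show "(w has_real_derivative U y * w y + g y) (at y within {0..T})"
      unfolding w_def
      by (rule derivative_eq_intros A[OF y] I[OF y] refl)+
        (simp add: algebra_simps flip: exp_add)
  next
    have "w 0 = c"
      by (simp add: w_def A_def I_def)
    also have "c = exp (A T) * (c + I T)"
      using AT by (simp add: c_def field_simps)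
    finally show "w 0 = w T"
      by (simp add: w_def)
  qed
qed

text \<open>Freezing the quadratic term turns the problem into a linear periodic one, and a solution
  is a fixed point of the resulting map. The hypothesis \<open>invariant\<close> makes it preserve
  the ball of radius \<open>C\<close>; \<open>contraction\<close> makes its Lipschitz constant
  \<open>2 * q * C / a\<close> less than 1. Neither condition mentions \<open>T\<close>.\<close>

lemma periodic_riccati_solution:
  fixes U H :: "real \<Rightarrow> real"
  assumes T: "0 < T" and a: "0 < a"
    and contU: "continuous_on {0..T} U" and contH: "continuous_on {0..T} H"
    and U: "\<And>y. y \<in> {0..T} \<Longrightarrow> U y \<le> - a"
    and H: "\<And>y. y \<in> {0..T} \<Longrightarrow> \<bar>H y\<bar> \<le> M"
    and q: "0 \<le> q" and C: "0 \<le> C"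
    and invariant: "M + q * C\<^sup>2 \<le> a * C" and contraction: "2 * q * C < a"
  obtains v where
    "\<And>y. y \<in> {0..T} \<Longrightarrow> (v has_real_derivative U y * v y + q * (v y)\<^sup>2 + H y) (at y within {0..T})"
    "v 0 = v T" "\<And>y. y \<in> {0..T} \<Longrightarrow> \<bar>v y\<bar> \<le> C"
proof -
  define rhs where "rhs v y = q * (v y)\<^sup>2 + H y" for v :: "real \<Rightarrow>\<^sub>C real" and y
  define sol where "sol v w \<longleftrightarrow> w 0 = w T \<and>
    (\<forall>y\<in>{0..T}. (w has_real_derivative U y * w y + rhs v y) (at y within {0..T}))"
    for v :: "real \<Rightarrow>\<^sub>C real" and w :: "real \<Rightarrow> real"
  have "continuous_on {0..T} (rhs v)" for v
    unfolding rhs_def by (intro continuous_intros contH) auto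
  then have "\<exists>w. sol v w" for v
    using periodic_linear_solution[OF T a contU _ U] unfolding sol_def by metis
  then obtain K where K: "\<And>v. sol v (K v)"
    by metis
  have K_per: "K v 0 = K v T"
    and K_deriv: "y \<in> {0..T} \<Longrightarrow>
      (K v has_real_derivative U y * K v y + rhs v y) (at y within {0..T})" for v y
    using K[of v] by (auto simp: sol_def)
  \<comment> \<open>Composing with this retraction onto \<open>{0..T}\<close> extends
    \<open>K v\<close>, which is controlled only there, to a bounded continuous function on the
    line, hence to a point of the complete space of such functions.\<close>
  define clip where "clip y = max 0 (min T y)" for y
  have clip: "clip y \<in> {0..T}" "y \<in> {0..T} \<Longrightarrow> clip y = y" for y
    using T by (auto simp: clip_def)
  have cont_clip: "continuous_on UNIV clip"
    unfolding clip_def by (intro continuous_intros)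
  define P where "P v = Bcontfun (K v \<circ> clip)" for v
  have P: "apply_bcontfun (P v) = K v \<circ> clip" for v
  proof -
    have contK: "continuous_on {0..T} (K v)"
      by (rule DERIV_continuous_on[OF K_deriv])
    then have "bounded (K v ` {0..T})"
      using compact_continuous_image compact_imp_bounded by blast
    then have "bounded (range (K v \<circ> clip))"
      by (rule bounded_subset) (use clip(1) in auto)
    moreover have "continuous_on UNIV (K v \<circ> clip)"
      by (intro continuous_on_compose cont_clip continuous_on_subset[OF contK]) (use clip(1) in auto)
    ultimately show ?thesis
      unfolding P_def by (intro Bcontfun_inverse) (simp add: bcontfun_def)
  qed
  have abs_le: "\<bar>v y\<bar> \<le> C" if "v \<in> cball 0 C" for v :: "real \<Rightarrow>\<^sub>C real" and y
    using norm_bounded[of v y] that by simp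
  have "\<exists>!v\<in>cball 0 C. P v = v"
  proof (rule Banach_fix)
    show "complete (cball (0 :: real \<Rightarrow>\<^sub>C real) C)"
      by (simp add: complete_eq_closed)
    show "cball (0 :: real \<Rightarrow>\<^sub>C real) C \<noteq> {}"
      using C by simp
    show "0 \<le> 2 * q * C / a" "2 * q * C / a < 1"
      using q C a contraction by simp_all
    show "P ` cball 0 C \<subseteq> cball 0 C"
    proof clarify
      fix v :: "real \<Rightarrow>\<^sub>C real" assume v: "v \<in> cball 0 C"
      \<comment> \<open>With inhomogeneity at most \<open>a * C\<close>, the linear bound returns
        exactly the radius \<open>C\<close>.\<close>
      have "\<bar>rhs v y\<bar> \<le> a * C" if "y \<in> {0..T}" for y
      proof -
        have "q * (v y)\<^sup>2 \<le> q * C\<^sup>2"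
          using power_mono[OF abs_le[OF v, of y], of 2] q by (intro mult_left_mono) simp_all
        moreover have "0 \<le> q * (v y)\<^sup>2"
          using q by simp
        ultimately show ?thesis
          using H[OF that] invariant unfolding rhs_def by linarith
      qed
      then have "\<bar>K v y\<bar> \<le> a * C / a" if "y \<in> {0..T}" for y
        using periodic_linear_bound[OF T a K_deriv K_per U] that by blast
      then have "norm (P v) \<le> C"
        using clip(1) a by (intro norm_bound) (simp add: P)
      then show "P v \<in> cball 0 C"
        by simp
    qed
    fix v1 v2 :: "real \<Rightarrow>\<^sub>C real" assume v: "v1 \<in> cball 0 C" "v2 \<in> cball 0 C"
    have "\<bar>rhs v1 y - rhs v2 y\<bar> \<le> 2 * q * C * dist v1 v2" for y
    proof -
      \<comment> \<open>\<open>H\<close> cancels, and factoring the difference of squares gives the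
        Lipschitz constant \<open>2 * q * C\<close> on the ball.\<close>
      have "rhs v1 y - rhs v2 y = q * ((v1 y + v2 y) * (v1 y - v2 y))"
        by (simp add: rhs_def power2_eq_square algebra_simps)
      moreover have "\<bar>v1 y + v2 y\<bar> \<le> 2 * C"
        using abs_le[OF v(1), of y] abs_le[OF v(2), of y] by linarith
      moreover have "\<bar>v1 y - v2 y\<bar> \<le> dist v1 v2"
        using dist_bounded[of v1 y v2] by (simp add: dist_real_def)
      ultimately have "\<bar>rhs v1 y - rhs v2 y\<bar> \<le> q * ((2 * C) * dist v1 v2)"
        using q C by (simp only: abs_mult abs_of_nonneg) (intro mult_left_mono mult_mono; simp)
      then show ?thesis
        by simp
    qed
    \<comment> \<open>By linearity the difference is again a periodic solution, so the same a priori
      bound yields the contraction estimate.\<close>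
    moreover have "((\<lambda>y. K v1 y - K v2 y) has_real_derivative
        U y * (K v1 y - K v2 y) + (rhs v1 y - rhs v2 y)) (at y within {0..T})"
      if "y \<in> {0..T}" for y
      using DERIV_diff[OF K_deriv[OF that] K_deriv[OF that]] by (simp add: algebra_simps)
    ultimately have "\<bar>K v1 y - K v2 y\<bar> \<le> 2 * q * C * dist v1 v2 / a" if "y \<in> {0..T}" for y
      using periodic_linear_bound[OF T a, of "\<lambda>y. K v1 y - K v2 y" U "\<lambda>y. rhs v1 y - rhs v2 y"]
        K_per U that by simp
    then show "dist (P v1) (P v2) \<le> 2 * q * C / a * dist v1 v2"
      using clip(1) by (intro dist_bound) (simp add: P dist_real_def)
  qed
  then obtain v where v: "v \<in> cball 0 C" "P v = v"
    by blast
  then have vK: "v y = K v y" if "y \<in> {0..T}" for y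
    using P[of v] clip(2)[OF that] by (metis comp_apply)
  show thesis
  proof
    fix y assume y: "y \<in> {0..T}"
    have "(v has_real_derivative U y * K v y + rhs v y) (at y within {0..T})"
      by (rule has_field_derivative_transform_within[OF K_deriv[OF y] zero_less_one y])
        (simp add: vK)
    then show "(v has_real_derivative U y * v y + q * (v y)\<^sup>2 + H y) (at y within {0..T})"
      using vK[OF y] by (simp add: rhs_def add.assoc)
    show "\<bar>v y\<bar> \<le> C"
      using abs_le[OF v(1)] .
  next
    show "v 0 = v T"
      using vK[of 0] vK[of T] K_per T by simp
  qed
qed

section \<open>Regularity of the coefficients\<close>

text \<open>A class containing all \<open>u k\<close>, closed under differentiation and consisting of bounded
  functions.\<close>

inductive trig_rational :: "(real \<Rightarrow> real) \<Rightarrow> bool" where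
  const: "trig_rational (\<lambda>_. c)"
| sin: "trig_rational sin"
| cos: "trig_rational cos"
| recip: "trig_rational (\<lambda>x. 1 / (2 + cos x))"
| add: "trig_rational f \<Longrightarrow> trig_rational g \<Longrightarrow> trig_rational (\<lambda>x. f x + g x)"
| mult: "trig_rational f \<Longrightarrow> trig_rational g \<Longrightarrow> trig_rational (\<lambda>x. f x * g x)"

lemma two_plus_cos_ge_1: "1 \<le> 2 + cos (x :: real)"
  using cos_ge_minus_one[of x] by linarith

lemma trig_rational_cmult: "trig_rational f \<Longrightarrow> trig_rational (\<lambda>x. c * f x)"
  by (rule trig_rational.mult[OF trig_rational.const])

lemma trig_rational_diff:
  assumes "trig_rational f" "trig_rational g"
  shows "trig_rational (\<lambda>x. f x - g x)"
  using trig_rational.add[OF assms(1) trig_rational_cmult[OF assms(2), of "- 1"]] by simp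

lemma trig_rational_sum:
  "(\<And>i. i \<in> S \<Longrightarrow> trig_rational (f i)) \<Longrightarrow> trig_rational (\<lambda>x. \<Sum>i\<in>S. f i x)"
proof (induction S rule: infinite_finite_induct)
  case (insert j S)
  then show ?case
    by (simp add: trig_rational.add)
qed (simp_all add: trig_rational.const)

text \<open>Stated with a witness so that it can be proved by induction over the class; uniqueness
  of derivatives then identifies the witness with \<open>deriv f\<close>.\<close>

lemma trig_rational_has_derivative:
  "trig_rational f \<Longrightarrow> \<exists>f'. trig_rational f' \<and> (\<forall>x. (f has_real_derivative f' x) (at x))"
proof (induction rule: trig_rational.induct)
  case (const c)
  show ?case
    by (intro exI[of _ "\<lambda>_. 0"]) (auto intro: trig_rational.const)
next
  case sin
  show ?case
    by (intro exI[of _ cos]) (auto intro: trig_rational.cos DERIV_sin)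
next
  case cos
  show ?case
    using trig_rational_cmult[OF trig_rational.sin, of "- 1"]
    by (intro exI[of _ "\<lambda>x. - 1 * sin x"]) (auto intro!: derivative_eq_intros)
next
  case recip
  let ?r = "\<lambda>x :: real. 1 / (2 + cos x)"
  have "((\<lambda>x. 1 / (2 + cos x)) has_real_derivative sin x * (?r x * ?r x)) (at x)" for x
    using two_plus_cos_ge_1[of x]
    by (auto intro!: derivative_eq_intros simp: power2_eq_square field_simps)
  moreover have "trig_rational (\<lambda>x. sin x * (?r x * ?r x))"
    by (intro trig_rational.intros)
  ultimately show ?case
    by blast
next
  case (add f g)
  then obtain f' g' where
    "trig_rational f'" "\<forall>x. (f has_real_derivative f' x) (at x)"
    "trig_rational g'" "\<forall>x. (g has_real_derivative g' x) (at x)"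
    by blast
  then show ?case
    by (intro exI[of _ "\<lambda>x. f' x + g' x"]) (simp add: trig_rational.add DERIV_add)
next
  case (mult f g)
  then obtain f' g' where
    "trig_rational f'" "\<forall>x. (f has_real_derivative f' x) (at x)"
    "trig_rational g'" "\<forall>x. (g has_real_derivative g' x) (at x)"
    by blast
  with mult.hyps show ?case
    by (intro exI[of _ "\<lambda>x. f' x * g x + g' x * f x"])
      (simp add: trig_rational.add trig_rational.mult DERIV_mult)
qed

lemma
  assumes "trig_rational f"
  shows trig_rational_DERIV: "(f has_real_derivative deriv f x) (at x)"
    and trig_rational_deriv: "trig_rational (deriv f)"
proof -
  obtain f' where f': "trig_rational f'" "\<And>x. (f has_real_derivative f' x) (at x)"
    using trig_rational_has_derivative[OF assms] by blast
  then have "deriv f = f'"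
    by (intro ext DERIV_imp_deriv)
  with f' show "(f has_real_derivative deriv f x) (at x)" "trig_rational (deriv f)"
    by simp_all
qed

lemma trig_rational_continuous: "trig_rational f \<Longrightarrow> continuous_on S f"
  by (rule DERIV_continuous_on[OF has_field_derivative_at_within[OF trig_rational_DERIV]])

lemma trig_rational_bounded: "trig_rational f \<Longrightarrow> \<exists>B. \<forall>x. \<bar>f x\<bar> \<le> B"
proof (induction rule: trig_rational.induct)
  case recip
  have "\<bar>1 / (2 + cos x)\<bar> \<le> 1" for x :: real
    using two_plus_cos_ge_1[of x] by simp
  then show ?case
    by blast
next
  case (add f g)
  then obtain B B' where B: "\<And>x. \<bar>f x\<bar> \<le> B" "\<And>x. \<bar>g x\<bar> \<le> B'"
    by blast
  have "\<bar>f x + g x\<bar> \<le> B + B'" for x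
    by (rule order_trans[OF abs_triangle_ineq add_mono[OF B]])
  then show ?case
    by blast
next
  case (mult f g)
  then obtain B B' where B: "\<And>x. \<bar>f x\<bar> \<le> B" "\<And>x. \<bar>g x\<bar> \<le> B'"
    by blast
  have "\<bar>f x * g x\<bar> \<le> B * B'" for x
    unfolding abs_mult by (rule mult_mono'[OF B]) simp_all
  then show ?case
    by blast
next
  case (const c)
  show ?case
    by (rule exI[of _ "\<bar>c\<bar>"]) simp
qed (rule exI[of _ 1], simp)+

text \<open>Strong induction, since the recursion for \<open>u (Suc m)\<close> involves all of
  \<open>u 1\<close> to \<open>u m\<close>, together with the derivative of
  \<open>u m\<close>.\<close>

lemma trig_rational_u: "trig_rational (u k)"
proof (induction k rule: less_induct)
  case (less k)
  show ?case
  proof (cases k)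
    case 0
    have "trig_rational (\<lambda>x. - 1 * (2 + cos x))"
      by (intro trig_rational_cmult trig_rational.intros)
    then show ?thesis
      by (simp add: 0)
  next
    case (Suc m)
    \<comment> \<open>Division by \<open>- (2 + cos x)\<close> is written as a product with the
      generator \<open>recip\<close>, so that the closure rules apply.\<close>
    have "trig_rational (\<lambda>x. (- 1 * (deriv (u m) x
        - 1 / 2 * (\<Sum>i = 1..m. u i x * u (Suc m - i) x))) * (1 / (2 + cos x)))"
      using less Suc
      by (intro trig_rational.mult trig_rational_cmult trig_rational_diff trig_rational_sum
          trig_rational_deriv trig_rational.recip) auto
    moreover have "a / - c = - 1 * a * (1 / c)" for a c :: real
      by simp
    ultimately show ?thesis
      unfolding Suc u.simps(2) by (simp only:)
  qed
qed

lemma u_0_le: "u 0 x \<le> - 1"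
  using two_plus_cos_ge_1[of x] by simp

lemmas u_DERIV = trig_rational_DERIV[OF trig_rational_u]
  and deriv_u_DERIV = trig_rational_DERIV[OF trig_rational_deriv[OF trig_rational_u]]

section \<open>The first integral\<close>

text \<open>The function \<open>H\<close> of the overview. The sum starts at \<open>k = 1\<close>,
  so the exponent \<open>k - 1\<close> is never truncated.\<close>

definition first_integral :: "nat \<Rightarrow> real \<Rightarrow> real \<Rightarrow> real" where
  "first_integral n \<epsilon> x =
    (\<Sum>k = 1..n. \<epsilon> ^ (k - 1) * ((\<Sum>i = k..n. u i x * u (n + k - i) x) / 2)) - deriv (u n) x"

text \<open>The reflection \<open>i\<close> to \<open>n + k - i\<close> maps \<open>{k..n}\<close>
  onto itself and swaps the two factors. Hence both halves of the product rule have the same sum,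
  and the factor 1/2 cancels the doubling.\<close>

lemma half_convolution_DERIV:
  "((\<lambda>x. (\<Sum>i = k..n. u i x * u (n + k - i) x) / 2) has_real_derivative
    (\<Sum>i = k..n. u i x * deriv (u (n + k - i)) x)) (at x)"
proof -
  have "(\<Sum>i = k..n. deriv (u i) x * u (n + k - i) x)
      = (\<Sum>i = k..n. deriv (u (n + k - i)) x * u (n + k - (n + k - i)) x)"
    by (rule sum.atLeastAtMost_rev)
  also have "\<dots> = (\<Sum>i = k..n. u i x * deriv (u (n + k - i)) x)"
    by (intro sum.cong) (auto simp del: u.simps)
  finally have "(\<Sum>i = k..n. deriv (u i) x * u (n + k - i) x + deriv (u (n + k - i)) x * u i x) / 2
      = (\<Sum>i = k..n. u i x * deriv (u (n + k - i)) x)"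
    by (simp add: sum.distrib mult.commute del: u.simps)
  moreover have "((\<lambda>x. (\<Sum>i = k..n. u i x * u (n + k - i) x) / 2) has_real_derivative
      (\<Sum>i = k..n. deriv (u i) x * u (n + k - i) x + deriv (u (n + k - i)) x * u i x) / 2) (at x)"
    by (intro DERIV_cdivide DERIV_sum DERIV_mult u_DERIV)
  ultimately show ?thesis
    by simp
qed

lemma trig_rational_F: "trig_rational (F n \<epsilon>)"
  unfolding F_def[abs_def]
  by (intro trig_rational_diff trig_rational_sum trig_rational_cmult trig_rational.mult
      trig_rational_deriv trig_rational_u)

text \<open>The division by \<open>\<epsilon>\<close> anticipates the chain rule: evaluated at
  \<open>\<epsilon> * y\<close>, the first integral has the derivative
  \<open>F n \<epsilon> (\<epsilon> * y)\<close> in \<open>y\<close>.\<close>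

lemma first_integral_DERIV:
  assumes "\<epsilon> \<noteq> 0"
  shows "(first_integral n \<epsilon> has_real_derivative F n \<epsilon> x / \<epsilon>) (at x)"
proof -
  have "(\<Sum>k = 1..n. \<epsilon> ^ (k - 1) * (\<Sum>i = k..n. u i x * deriv (u (n + k - i)) x))
      = (\<Sum>k = 1..n. \<epsilon> ^ k * (\<Sum>i = k..n. u i x * deriv (u (n + k - i)) x)) / \<epsilon>"
    unfolding sum_divide_distrib using assms
    by (intro sum.cong refl) (auto simp: power_diff simp del: u.simps)
  then have "F n \<epsilon> x / \<epsilon> =
      (\<Sum>k = 1..n. \<epsilon> ^ (k - 1) * (\<Sum>i = k..n. u i x * deriv (u (n + k - i)) x))
      - deriv (deriv (u n)) x"
    using assms by (simp add: F_def diff_divide_distrib del: u.simps)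
  then show ?thesis
    unfolding first_integral_def
    by (simp only:) (intro DERIV_diff DERIV_sum DERIV_cmult half_convolution_DERIV deriv_u_DERIV)
qed

section \<open>Bounds uniform in \<open>\<epsilon>\<close>\<close>

lemma abs_power_sum_le:
  fixes \<epsilon> :: real
  assumes "0 \<le> \<epsilon>" "\<epsilon> \<le> 1" and "\<And>k. k \<in> S \<Longrightarrow> \<bar>h k\<bar> \<le> B k"
  shows "\<bar>\<Sum>k\<in>S. \<epsilon> ^ m k * h k\<bar> \<le> sum B S"
proof (rule order_trans[OF sum_abs sum_mono])
  fix k assume "k \<in> S"
  have "\<bar>\<epsilon> ^ m k * h k\<bar> \<le> 1 * \<bar>h k\<bar>"
    unfolding abs_mult using assms(1,2) by (intro mult_right_mono) (auto simp: power_le_one)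
  then show "\<bar>\<epsilon> ^ m k * h k\<bar> \<le> B k"
    using assms(3)[OF \<open>k \<in> S\<close>] by linarith
qed

lemma first_integral_bounded:
  obtains M where "0 \<le> M" "\<And>\<epsilon> x. 0 \<le> \<epsilon> \<Longrightarrow> \<epsilon> \<le> 1 \<Longrightarrow> \<bar>first_integral n \<epsilon> x\<bar> \<le> M"
proof -
  let ?h = "\<lambda>k x. 1 / 2 * (\<Sum>i = k..n. u i x * u (n + k - i) x)"
  have "trig_rational (?h k)" for k
    by (intro trig_rational_cmult trig_rational_sum trig_rational.mult trig_rational_u)
  then have "\<forall>k. \<exists>B. \<forall>x. \<bar>?h k x\<bar> \<le> B"
    by (intro allI trig_rational_bounded)
  then obtain B where B: "\<And>k x. \<bar>?h k x\<bar> \<le> B k"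
    by (auto dest!: choice)
  obtain B' where B': "\<And>x. \<bar>deriv (u n) x\<bar> \<le> B'"
    using trig_rational_bounded[OF trig_rational_deriv[OF trig_rational_u]] by blast
  have *: "\<bar>first_integral n \<epsilon> x\<bar> \<le> sum B {1..n} + B'" if "0 \<le> \<epsilon>" "\<epsilon> \<le> 1" for \<epsilon> x
  proof -
    have "\<bar>\<Sum>k = 1..n. \<epsilon> ^ (k - 1) * ?h k x\<bar> \<le> sum B {1..n}"
      by (rule abs_power_sum_le[OF that B])
    moreover have "first_integral n \<epsilon> x = (\<Sum>k = 1..n. \<epsilon> ^ (k - 1) * ?h k x) - deriv (u n) x"
      by (simp add: first_integral_def del: u.simps)
    ultimately show ?thesis
      using B'[of x] by linarith
  qed
  from order_trans[OF abs_ge_zero *[of 0 0]] have "0 \<le> sum B {1..n} + B'"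
    by simp
  from that[OF this *] show thesis .
qed

text \<open>The term \<open>u 0\<close> supplies \<open>- 1\<close>, and every other term carries a
  factor \<open>\<epsilon>\<close>; this makes the linear coefficient uniformly negative for small
  \<open>\<epsilon>\<close>.\<close>

lemma u_partial_sum_le:
  obtains L where "0 \<le> L"
    "\<And>\<epsilon> x. 0 \<le> \<epsilon> \<Longrightarrow> \<epsilon> \<le> 1 \<Longrightarrow> (\<Sum>k = 0..n. \<epsilon> ^ k * u k x) \<le> - 1 + \<epsilon> * L"
proof -
  have "\<forall>k. \<exists>B. \<forall>x. \<bar>u k x\<bar> \<le> B"
    by (intro allI trig_rational_bounded trig_rational_u)
  then obtain B where B: "\<And>k x. \<bar>u k x\<bar> \<le> B k"
    by (auto dest!: choice simp del: u.simps)
  have "0 \<le> sum B {1..n}"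
    by (rule sum_nonneg[OF order_trans[OF abs_ge_zero B]])
  moreover have "(\<Sum>k = 0..n. \<epsilon> ^ k * u k x) \<le> - 1 + \<epsilon> * sum B {1..n}"
    if \<epsilon>: "0 \<le> \<epsilon>" "\<epsilon> \<le> 1" for \<epsilon> x
  proof -
    have "(\<Sum>k = 0..n. \<epsilon> ^ k * u k x) = u 0 x + (\<Sum>k = 1..n. \<epsilon> ^ k * u k x)"
      by (simp add: sum.atLeast_Suc_atMost del: u.simps)
    also have "(\<Sum>k = 1..n. \<epsilon> ^ k * u k x) = \<epsilon> * (\<Sum>k = 1..n. \<epsilon> ^ (k - 1) * u k x)"
      unfolding sum_distrib_left
      by (intro sum.cong refl) (auto simp: power_eq_if simp del: u.simps)
    also have "\<dots> \<le> \<epsilon> * sum B {1..n}"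
    proof (rule mult_left_mono[OF _ \<epsilon>(1)])
      have "\<bar>\<Sum>k = 1..n. \<epsilon> ^ (k - 1) * u k x\<bar> \<le> sum B {1..n}"
        by (rule abs_power_sum_le[OF \<epsilon> B])
      then show "(\<Sum>k = 1..n. \<epsilon> ^ (k - 1) * u k x) \<le> sum B {1..n}"
        by linarith
    qed
    finally show ?thesis
      using u_0_le[of x] by linarith
  qed
  ultimately show thesis
    using that by blast
qed

section \<open>Choice of constants and differentiation of the Riccati equation\<close>

theorem theorem1p5:
  fixes n :: nat
  assumes "n \<ge> 1"
  shows "\<exists>\<epsilon>\<^sub>0 > 0. \<exists>C > 0. \<forall>\<epsilon>::real. 0 < \<epsilon> \<and> \<epsilon> < \<epsilon>\<^sub>0 \<longrightarrow>
    (\<exists>v v' v'' :: real \<Rightarrow> real.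
      (\<forall>y \<in> {0..2 * pi / \<epsilon>}. (v has_real_derivative v' y) (at y within {0..2 * pi / \<epsilon>})) \<and>
      (\<forall>y \<in> {0..2 * pi / \<epsilon>}. (v' has_real_derivative v'' y) (at y within {0..2 * pi / \<epsilon>})) \<and>
      continuous_on {0..2 * pi / \<epsilon>} v'' \<and>
      (\<forall>y \<in> {0..2 * pi / \<epsilon>}.
        - v'' y + \<epsilon> ^ (n + 1) * v y * v' y
        + (\<Sum>k = 0..n. \<epsilon> ^ k * u k (\<epsilon> * y)) * v' y
        + (\<Sum>k = 0..n. \<epsilon> ^ (k + 1) * deriv (u k) (\<epsilon> * y)) * v y
        + F n \<epsilon> (\<epsilon> * y) = 0) \<and>
      v 0 = v (2 * pi / \<epsilon>) \<and>
      (\<forall>y \<in> {0..2 * pi / \<epsilon>}. \<bar>v y\<bar> \<le> C))"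
proof -
  obtain M where M: "0 \<le> M" "\<And>\<epsilon> x. 0 \<le> \<epsilon> \<Longrightarrow> \<epsilon> \<le> 1 \<Longrightarrow> \<bar>first_integral n \<epsilon> x\<bar> \<le> M"
    by (rule first_integral_bounded[of n]) blast
  obtain L where L: "0 \<le> L"
    "\<And>\<epsilon> x. 0 \<le> \<epsilon> \<Longrightarrow> \<epsilon> \<le> 1 \<Longrightarrow> (\<Sum>k = 0..n. \<epsilon> ^ k * u k x) \<le> - 1 + \<epsilon> * L"
    by (rule u_partial_sum_le[of n]) blast
  \<comment> \<open>With \<open>a = 1 / 2\<close> and \<open>q * C \<le> 1 / 4\<close>, the
    invariance condition reduces to \<open>M \<le> C / 4\<close>; the added 1 makes \<open>C\<close>
    positive even if \<open>M = 0\<close>.\<close>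
  define C where "C = 4 * M + 1"
  \<comment> \<open>The three bounds give, in order, \<open>\<epsilon> < 1\<close>,
    \<open>\<epsilon> * C < 1 / 2\<close> for the contraction, and
    \<open>\<epsilon> * L \<le> 1 / 2\<close> for \<open>U y \<le> - (1 / 2)\<close>. Using
    \<open>L + 1\<close> avoids a zero denominator.\<close>
  define \<epsilon>\<^sub>0 where "\<epsilon>\<^sub>0 = min 1 (min (1 / (2 * C)) (1 / (2 * (L + 1))))"
  have C: "C > 0"
    using M(1) by (simp add: C_def)
  have "\<epsilon>\<^sub>0 > 0"
    using C L(1) by (simp add: \<epsilon>\<^sub>0_def)
  show ?thesis
  proof (rule exI[of _ \<epsilon>\<^sub>0], intro conjI \<open>\<epsilon>\<^sub>0 > 0\<close>, rule exI[of _ C], intro conjI C allI impI)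
    fix \<epsilon> :: real assume "0 < \<epsilon> \<and> \<epsilon> < \<epsilon>\<^sub>0"
    then have \<epsilon>: "0 < \<epsilon>" "\<epsilon> < 1" "\<epsilon> * C < 1 / 2" "\<epsilon> * L \<le> 1 / 2"
      using C L(1) by (auto simp: \<epsilon>\<^sub>0_def field_simps)
    define T where "T = 2 * pi / \<epsilon>"
    \<comment> \<open>The 1/2 comes from integrating \<open>v * v'\<close> to half the square of
      \<open>v\<close>.\<close>
    define q where "q = \<epsilon> ^ (n + 1) / 2"
    define U where "U y = (\<Sum>k = 0..n. \<epsilon> ^ k * u k (\<epsilon> * y))" for y
    define U' where "U' y = (\<Sum>k = 0..n. \<epsilon> ^ (k + 1) * deriv (u k) (\<epsilon> * y))" for y
    define H where "H y = first_integral n \<epsilon> (\<epsilon> * y)" for y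
    have lin: "((\<lambda>y. \<epsilon> * y) has_real_derivative \<epsilon>) (at y)" for y
      by (auto intro!: derivative_eq_intros)
    have U_DERIV: "(U has_real_derivative U' y) (at y)" for y
    proof -
      have "(U has_real_derivative (\<Sum>k = 0..n. \<epsilon> ^ k * (deriv (u k) (\<epsilon> * y) * \<epsilon>))) (at y)"
        unfolding U_def by (intro DERIV_sum DERIV_cmult DERIV_chain2[OF u_DERIV] lin)
      then show ?thesis
        by (simp add: U'_def mult_ac del: u.simps)
    qed
    have H_DERIV: "(H has_real_derivative F n \<epsilon> (\<epsilon> * y)) (at y)" for y
      using DERIV_chain2[OF first_integral_DERIV lin, of \<epsilon> n y] \<epsilon>(1) by (simp add: H_def[abs_def])
    have contU: "continuous_on S U" and contH: "continuous_on S H" for S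
      using DERIV_continuous_on[OF has_field_derivative_at_within[OF U_DERIV]]
        DERIV_continuous_on[OF has_field_derivative_at_within[OF H_DERIV]] .
    have cont_scaled: "continuous_on S (\<lambda>y. f (\<epsilon> * y))" if "trig_rational f" for S f
      by (rule continuous_on_compose2[OF trig_rational_continuous[OF that, of UNIV]])
        (auto intro: continuous_intros)
    have contU': "continuous_on S U'" for S
      unfolding U'_def
      by (intro continuous_on_sum continuous_on_mult_left
          cont_scaled[OF trig_rational_deriv[OF trig_rational_u]])
    have contF: "continuous_on S (\<lambda>y. F n \<epsilon> (\<epsilon> * y))" for S
      by (rule cont_scaled[OF trig_rational_F])
    have q: "0 \<le> q" "q * C \<le> 1 / 4" "2 * q * C < 1 / 2"
    proof -
      have "\<epsilon> ^ (n + 1) \<le> \<epsilon>"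
        using \<epsilon>(1,2) by (simp add: mult_left_le power_le_one)
      from mult_right_mono[OF this, of C] have "2 * q * C \<le> \<epsilon> * C"
        using C by (simp add: q_def)
      with \<epsilon>(3) show "2 * q * C < 1 / 2" "q * C \<le> 1 / 4"
        by linarith+
      show "0 \<le> q"
        using \<epsilon>(1) by (simp add: q_def)
    qed
    have "q * C\<^sup>2 \<le> 1 / 4 * C"
      using mult_right_mono[OF q(2), of C] C by (simp only: power2_eq_square mult.assoc)
    then have invariant: "M + q * C\<^sup>2 \<le> 1 / 2 * C"
      using M(1) C_def by linarith
    have U_le: "U y \<le> - (1 / 2)" and H_le: "\<bar>H y\<bar> \<le> M" for y
      using L(2)[of \<epsilon> "\<epsilon> * y"] M(2)[of \<epsilon> "\<epsilon> * y"] \<epsilon> by (auto simp: U_def H_def simp del: u.simps)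
    have T: "0 < T"
      using \<epsilon>(1) by (simp add: T_def)
    obtain v where v:
      "\<And>y. y \<in> {0..T} \<Longrightarrow> (v has_real_derivative U y * v y + q * (v y)\<^sup>2 + H y) (at y within {0..T})"
      "v 0 = v T" "\<And>y. y \<in> {0..T} \<Longrightarrow> \<bar>v y\<bar> \<le> C"
      by (rule periodic_riccati_solution[OF T half_gt_zero[OF zero_less_one] contU contH
            U_le H_le q(1) less_imp_le[OF C] invariant q(3)]) blast
    \<comment> \<open>\<open>v'\<close> is the Riccati right-hand side and \<open>v''\<close> its
      formal derivative, both given by formulas for every \<open>y\<close>. The second-order
      equation thus becomes an algebraic identity, and \<open>v''\<close> inherits continuity from
      \<open>v\<close> and \<open>v'\<close>.\<close>
    define v' where "v' y = U y * v y + q * (v y)\<^sup>2 + H y" for y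
    define v'' where "v'' y = U' y * v y + U y * v' y + 2 * q * v y * v' y + F n \<epsilon> (\<epsilon> * y)" for y
    have v_DERIV: "(v has_real_derivative v' y) (at y within {0..T})" if "y \<in> {0..T}" for y
      using v(1)[OF that] by (simp add: v'_def)
    have v'_DERIV: "(v' has_real_derivative v'' y) (at y within {0..T})" if "y \<in> {0..T}" for y
      using DERIV_add[OF DERIV_add[OF
          DERIV_mult[OF has_field_derivative_at_within[OF U_DERIV] v_DERIV[OF that]]
          DERIV_cmult[OF DERIV_power[OF v_DERIV[OF that], of 2], of q]]
          has_field_derivative_at_within[OF H_DERIV]]
      by (simp add: v'_def[abs_def] v''_def algebra_simps)
    have "continuous_on {0..T} v" "continuous_on {0..T} v'"
      by (rule DERIV_continuous_on[OF v_DERIV] DERIV_continuous_on[OF v'_DERIV]; assumption)+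
    then have "continuous_on {0..T} v''"
      unfolding v''_def by (intro continuous_intros contU contU' contF)
    moreover have eq: "- v'' y + \<epsilon> ^ (n + 1) * v y * v' y + U y * v' y + U' y * v y
        + F n \<epsilon> (\<epsilon> * y) = 0" for y
      by (simp add: v''_def q_def)
    ultimately show "\<exists>v v' v'' :: real \<Rightarrow> real.
      (\<forall>y \<in> {0..2 * pi / \<epsilon>}. (v has_real_derivative v' y) (at y within {0..2 * pi / \<epsilon>})) \<and>
      (\<forall>y \<in> {0..2 * pi / \<epsilon>}. (v' has_real_derivative v'' y) (at y within {0..2 * pi / \<epsilon>})) \<and>
      continuous_on {0..2 * pi / \<epsilon>} v'' \<and>
      (\<forall>y \<in> {0..2 * pi / \<epsilon>}.
        - v'' y + \<epsilon> ^ (n + 1) * v y * v' y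
        + (\<Sum>k = 0..n. \<epsilon> ^ k * u k (\<epsilon> * y)) * v' y
        + (\<Sum>k = 0..n. \<epsilon> ^ (k + 1) * deriv (u k) (\<epsilon> * y)) * v y
        + F n \<epsilon> (\<epsilon> * y) = 0) \<and>
      v 0 = v (2 * pi / \<epsilon>) \<and>
      (\<forall>y \<in> {0..2 * pi / \<epsilon>}. \<bar>v y\<bar> \<le> C)"
      unfolding T_def[symmetric] U_def[symmetric] U'_def[symmetric]
      by (intro exI[of _ v] exI[of _ v'] exI[of _ v''] conjI ballI)
        (assumption | rule v_DERIV v'_DERIV v(2,3) eq)+
  qed
qed

end
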